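(* Let $\gamma>0$ and let $\kappa\ge2(\sqrt{2c_1}+\gamma)$, where $c_1$ is the constant in Talagrand's inequality (see context). Then there is a constant $C$ depending on the choice of $\kappa,\gamma$ and $\delta$ such that $$\mathbb E\left[\sup_{u\in\mathbb R}\frac{\left|\frac1{\check\varphi_n(u)}-\frac1{\varphi(u)}\right|^2}{\frac{(\log n)\,w(u)^{-2}n^{-1}}{|\varphi(u)|^4}\wedge\frac1{|\varphi(u)|^2}}\right]\le C .$$
   Context: $X$ is a real Lévy process with Lévy measure $\nu$, of pure jump type (no Gaussian part), with $\int_{\{|x|\le1\}}|x|\nu(dx)<\infty$, without drift, and $\int|x|^2\nu(dx)<\infty$. It is observed at times $1,2,\dots,2n$, $n\ge2$; $Z_k:=X_k-X_{k-1}$ are the i.i.d. increments, $\varphi(u)=\mathbb E[e^{iuX_1}]$ (which has no zeros) and $\hat\varphi_n(u):=\frac1n\sum_{k=1}^ne^{iuZ_k}$. For a fixed $\delta>0$ the weight function is $w(u)=(\log(e+|u|))^{-1/2-\delta}$. For the constant $\kappa>0$, the truncated empirical characteristic function is $$\check\varphi_n(u):=\begin{cases}\hat\varphi_n(u),&|\hat\varphi_n(u)|\ge\kappa(\log n)^{1/2}w(u)^{-1}n^{-1/2},\\ \kappa(\log n)^{1/2}w(u)^{-1}n^{-1/2},&\text{else}.\end{cases}$$ Talagrand's inequality (defining $c_1$): let $I$ be countable and for each $i\in I$ let $X^{(i)}_1,\dots,X^{(i)}_n$ be centred i.i.d. complex random variables with $\|X^{(i)}_1\|_\infty\le B<\infty$,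 $v^2:=\sup_i\mathrm{Var}\,X_1^{(i)}$, $S_n^{(i)}=\frac1n\sum_jX_j^{(i)}$; then for $\varepsilon>0$ there are positive constants $c_1$ and $c_2=c_2(\varepsilon)$ depending only on $\varepsilon$ with $\mathbb P\big(\sup_i|S_n^{(i)}|\ge(1+\varepsilon)\mathbb E[\sup_i|S_n^{(i)}|]+t\big)\le2\exp\big(-n(\frac{t^2}{c_1v^2}\wedge\frac t{c_2B})\big)$ for all $t>0$. $a\wedge b=\min(a,b)$.
   Formalization: The constant C may depend on the law of the fixed process X as well as on κ, γ and δ (but not on n); a C uniform over all X is impossible, as dilating a compound Poisson process whose jumps have a density shows. *)

theory Defs
  imports "HOL-Probability.Probability"
begin

section \<open>Levy processes\<close>

text \<open>Only the times \<open>t \<ge> 0\<close> matter; the values of \<open>X\<close> at negative times are junk.\<close>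

definition levy_process :: "'a measure \<Rightarrow> (real \<Rightarrow> 'a \<Rightarrow> real) \<Rightarrow> bool" where
  "levy_process M X \<longleftrightarrow>
     prob_space M \<and>
     (\<forall>t\<ge>0. X t \<in> borel_measurable M) \<and>
     (AE \<omega> in M. X 0 \<omega> = 0) \<and>
     (\<forall>(t::nat \<Rightarrow> real) m. 0 \<le> t 0 \<and> mono t \<longrightarrow>
        prob_space.indep_vars M (\<lambda>_. borel) (\<lambda>k \<omega>. X (t (Suc k)) \<omega> - X (t k) \<omega>) {..<m}) \<and>
     (\<forall>s\<ge>0. \<forall>h\<ge>0. distr M borel (\<lambda>\<omega>. X (s + h) \<omega> - X s \<omega>) = distr M borel (X h)) \<and>
     (\<forall>s\<ge>0. \<forall>\<eta>>0.
        ((\<lambda>t. measure M {\<omega> \<in> space M. \<bar>X t \<omega> - X s \<omega>\<bar> > \<eta>}) \<longlongrightarrow> 0) (at s within {0..})) \<and>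
     (AE \<omega> in M. \<forall>t\<ge>0. ((\<lambda>s. X s \<omega>) \<longlongrightarrow> X t \<omega>) (at_right t) \<and>
        (t > 0 \<longrightarrow> (\<exists>l. ((\<lambda>s. X s \<omega>) \<longlongrightarrow> l) (at_left t))))"

definition levy_measure :: "real measure \<Rightarrow> bool" where
  "levy_measure \<nu> \<longleftrightarrow>
     sets \<nu> = sets borel \<and> emeasure \<nu> {0} = 0 \<and> integrable \<nu> (\<lambda>x. min 1 (x\<^sup>2))"

text \<open>The Levy-Khintchine exponent of the triplet \<open>(b, \<sigma>2, \<nu>)\<close>, where \<open>\<sigma>2\<close> is the Gaussian
  variance and \<open>b\<close> is relative to the truncation of the jumps at \<open>1\<close>.\<close>

definition levy_exponent :: "real \<Rightarrow> real \<Rightarrow> real measure \<Rightarrow> real \<Rightarrow> complex" where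
  "levy_exponent b \<sigma>2 \<nu> u =
     \<i> * complex_of_real (b * u) - complex_of_real (\<sigma>2 * u\<^sup>2 / 2)
     + (LINT x|\<nu>. (iexp (u * x) - 1 - \<i> * complex_of_real (u * x * indicator {-1..1} x)))"

definition has_levy_triplet ::
    "'a measure \<Rightarrow> (real \<Rightarrow> 'a \<Rightarrow> real) \<Rightarrow> real \<Rightarrow> real \<Rightarrow> real measure \<Rightarrow> bool" where
  "has_levy_triplet M X b \<sigma>2 \<nu> \<longleftrightarrow>
     levy_measure \<nu> \<and> 0 \<le> \<sigma>2 \<and>
     (\<forall>t\<ge>0. \<forall>u. char (distr M borel (X t)) u = exp (complex_of_real t * levy_exponent b \<sigma>2 \<nu> u))"

text \<open>When the small jumps are summable, the drift of the process is
  \<open>b\<close> minus the integral of \<open>x\<close> over \<open>[-1, 1]\<close> with respect to \<open>\<nu>\<close>.  Vanishing drift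
  therefore fixes \<open>b\<close>, and the exponent becomes the integral of \<open>exp(iux) - 1\<close>.\<close>

definition pure_jump_driftless ::
    "'a measure \<Rightarrow> (real \<Rightarrow> 'a \<Rightarrow> real) \<Rightarrow> real measure \<Rightarrow> bool" where
  "pure_jump_driftless M X \<nu> \<longleftrightarrow>
     levy_process M X \<and>
     set_integrable \<nu> {-1..1} (\<lambda>x. \<bar>x\<bar>) \<and>
     has_levy_triplet M X (LINT x:{-1..1}|\<nu>. x) 0 \<nu>"

section \<open>Empirical characteristic functions\<close>

definition incr :: "(real \<Rightarrow> 'a \<Rightarrow> real) \<Rightarrow> nat \<Rightarrow> 'a \<Rightarrow> real" where
  "incr X k \<omega> = X (real k) \<omega> - X (real k - 1) \<omega>"

definition phi :: "'a measure \<Rightarrow> (real \<Rightarrow> 'a \<Rightarrow> real) \<Rightarrow> real \<Rightarrow> complex" where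
  "phi M X u = char (distr M borel (X 1)) u"

definition phi_hat :: "(real \<Rightarrow> 'a \<Rightarrow> real) \<Rightarrow> nat \<Rightarrow> real \<Rightarrow> 'a \<Rightarrow> complex" where
  "phi_hat X n u \<omega> = (\<Sum>k=1..n. iexp (u * incr X k \<omega>)) / of_nat n"

definition weight :: "real \<Rightarrow> real \<Rightarrow> real" where
  "weight \<delta> u = ln (exp 1 + \<bar>u\<bar>) powr (- 1 / 2 - \<delta>)"

definition threshold :: "real \<Rightarrow> real \<Rightarrow> nat \<Rightarrow> real \<Rightarrow> real" where
  "threshold \<kappa> \<delta> n u = \<kappa> * sqrt (ln (real n)) * inverse (weight \<delta> u) * inverse (sqrt (real n))"

definition phi_check ::
    "real \<Rightarrow> real \<Rightarrow> (real \<Rightarrow> 'a \<Rightarrow> real) \<Rightarrow> nat \<Rightarrow> real \<Rightarrow> 'a \<Rightarrow> complex" where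
  "phi_check \<kappa> \<delta> X n u \<omega> =
     (if cmod (phi_hat X n u \<omega>) \<ge> threshold \<kappa> \<delta> n u then phi_hat X n u \<omega>
      else complex_of_real (threshold \<kappa> \<delta> n u))"

section \<open>Talagrand's inequality\<close>

text \<open>\<open>Y i j\<close> is the \<open>j\<close>-th variable of the \<open>i\<close>-th sequence.  Independence and identical
  distribution in \<open>j\<close> are required of the whole vector \<open>(Y i j)\<close>, \<open>i \<in> I\<close>: asking this only
  for each \<open>i\<close> separately would make the inequality false.
  The sample space ranges over all probability spaces on the type \<open>'a\<close>, since one cannot
  quantify over types; countable index sets are represented by subsets of the natural numbers.\<close>

definition talagrand_inequality :: "'a itself \<Rightarrow> real \<Rightarrow> real \<Rightarrow> real \<Rightarrow> bool" where
  "talagrand_inequality _ \<epsilon> c1 c2 \<longleftrightarrow>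
     (\<forall>(P::'a measure) (I::nat set) (Y::nat \<Rightarrow> nat \<Rightarrow> 'a \<Rightarrow> complex) (n::nat) (B::real).
        let vec = (\<lambda>j \<omega>. \<lambda>i\<in>I. Y i j \<omega>);
            E = (\<Pi>\<^sub>M i\<in>I. (borel :: complex measure));
            S = (\<lambda>\<omega>. SUP i\<in>I. cmod ((\<Sum>j=1..n. Y i j \<omega>) / of_nat n));
            v2 = (SUP i\<in>I. LINT \<omega>|P. (cmod (Y i 1 \<omega> - (LINT \<omega>'|P. Y i 1 \<omega>')))\<^sup>2)
        in prob_space P \<and> I \<noteq> {} \<and> 1 \<le> n \<and>
           prob_space.indep_vars P (\<lambda>_. E) vec {1..n} \<and>
           (\<forall>j\<in>{1..n}. distr P E (vec j) = distr P E (vec 1)) \<and>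
           (\<forall>i\<in>I. (LINT \<omega>|P. Y i 1 \<omega>) = 0) \<and>
           (\<forall>i\<in>I. AE \<omega> in P. cmod (Y i 1 \<omega>) \<le> B)
           \<longrightarrow> (\<forall>t>0. measure P {\<omega> \<in> space P. S \<omega> \<ge> (1 + \<epsilon>) * (LINT \<omega>'|P. S \<omega>') + t}
                  \<le> 2 * exp (- real n * min (t\<^sup>2 / (c1 * v2)) (t / (c2 * B)))))"

definition talagrand_constant :: "'a itself \<Rightarrow> real \<Rightarrow> real \<Rightarrow> bool" where
  "talagrand_constant T \<epsilon> c1 \<longleftrightarrow> 0 < c1 \<and> (\<exists>c2>0. talagrand_inequality T \<epsilon> c1 c2)"

end

theory Submission
  imports Defs
begin

text \<open>
  Put \<open>T(u) = sqrt (ln n / n) / w(u)\<close>, so that the truncation level is \<open>\<kappa> T(u)\<close> and the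
  denominator in the theorem is the minimum of \<open>T\<^sup>2 / \<bar>\<phi>\<bar>^4\<close> and \<open>1 / \<bar>\<phi>\<bar>\<^sup>2\<close>.  Measure the
  uniform error of the empirical characteristic function in units of \<open>T\<close>: let
  \<open>d = sup\<^sub>u \<bar>\<phi>\<^sub>n(u) - \<phi>(u)\<bar> / T(u)\<close>.

  The first point is that the supremum of the ratio is at most a constant times \<open>(1 + d)^4\<close>
  (\<open>truncated_inverse_error\<close>).  It is purely deterministic: the truncated function \<open>h\<close> still
  satisfies \<open>\<bar>h - \<phi>\<bar> \<le> (2 \<kappa> + d) T\<close>, and by construction \<open>\<bar>h\<bar> \<ge> \<kappa> T\<close>.  This holds for every
  size of \<open>d\<close> relative to \<open>\<kappa>\<close>, so that bounding \<open>d\<close> by any constant suffices.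

  The second point is that \<open>d\<close> is bounded by a constant outside an event of probability
  \<open>O(n^(-2))\<close> (\<open>prob_exceptional\<close>, \<open>uniform_deviation\<close>).  Because
  \<open>T(u)\<^sup>2 \<ge> ln n * ln (e + \<bar>u\<bar>) / n\<close>, Hoeffding's inequality makes the probability of a deviation
  larger than \<open>a T(u)\<close> at a single \<open>u\<close> smaller than \<open>4 n^(-p) (e + \<bar>u\<bar>)^(-q)\<close>, with \<open>p\<close> and \<open>q\<close> as
  large as desired if \<open>a\<close> is large.  This is summable over the whole grid of mesh \<open>n^(-3)\<close> on the
  half line.  Between the nodes both characteristic functions are Lipschitz, the
  empirical one with the constant \<open>\<Sum> \<bar>Z\<^sub>k\<bar> / n\<close>, which by Markov's inequality exceeds \<open>n\<^sup>2\<close> only with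
  probability \<open>O(n^(-2))\<close>.

  On the exceptional event the trivial bound \<open>\<bar>\<phi>\<^sub>n - \<phi>\<bar> \<le> 2\<close> gives \<open>d = O(sqrt n)\<close>, hence a ratio of
  order \<open>n\<^sup>2\<close> (\<open>trivial_deviation\<close>), which is exactly balanced by the probability of the event.

  The Lipschitz argument needs \<open>E \<bar>X\<^sub>1\<bar> < \<infinity>\<close>, which has to be read off from the characteristic
  exponent: the moments of \<open>\<nu>\<close> give \<open>1 - Re \<phi>(u) = O(u\<^sup>2)\<close> (\<open>Re_exp_levy_exponent_bound\<close>), and this
  forces a finite second moment (\<open>second_moment_of_char_bound\<close>).
\<close>

section \<open>Inverting a truncated approximation\<close>

text \<open>
  With \<open>x = \<bar>h - f\<bar> / \<bar>h\<bar>\<close> the error of the inverse is \<open>x / \<bar>f\<bar>\<close>, so that the quotient is the larger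
  of \<open>x\<^sup>2\<close> and \<open>(x \<bar>f\<bar> / T)\<^sup>2\<close>.  Both are controlled by \<open>\<bar>h - f\<bar> \<le> e T\<close> and \<open>\<bar>h\<bar> \<ge> \<kappa> T\<close>, where
  \<open>e = 2 \<kappa> + d\<close>: clearly \<open>x \<le> e / \<kappa>\<close>, and \<open>\<bar>f\<bar> \<le> (1 + x) \<bar>h\<bar>\<close> gives \<open>x \<bar>f\<bar> / T \<le> e (1 + e / \<kappa>)\<close>.
  The polynomial dependence on \<open>d\<close> matters because the lemma is applied both with a constant \<open>d\<close> and
  with \<open>d\<close> of order \<open>sqrt n\<close>.
\<close>

lemma truncated_inverse_error:
  fixes f g :: complex and \<kappa> T d :: real
  assumes \<kappa>: "\<kappa> > 0" and T: "T > 0" and d: "d \<ge> 0" and f: "f \<noteq> 0"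
    and close: "cmod (g - f) \<le> d * T"
  defines "h \<equiv> if cmod g \<ge> \<kappa> * T then g else complex_of_real (\<kappa> * T)"
  shows "(cmod (1 / h - 1 / f))\<^sup>2 / min (T\<^sup>2 / cmod f ^ 4) (1 / (cmod f)\<^sup>2)
    \<le> (((2 * \<kappa> + 1) / \<kappa>)\<^sup>2 + (2 * \<kappa> + 1)\<^sup>2 * (1 + (2 * \<kappa> + 1) / \<kappa>)\<^sup>2) * (1 + d) ^ 4"
proof -
  define F where "F = cmod f"
  define e where "e = 2 * \<kappa> + d"
  define b where "b = 2 * \<kappa> + 1"
  define q where "q = 1 + d"
  have F: "F > 0" using f by (simp add: F_def)
  have e: "e \<ge> 0" using \<kappa> d by (simp add: e_def)
  have b: "b \<ge> 0" using \<kappa> by (simp add: b_def)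
  have q: "q \<ge> 1" using d by (simp add: q_def)
  have h_ge: "cmod h \<ge> \<kappa> * T"
    using \<kappa> T by (simp add: h_def norm_mult)
  have h: "cmod h > 0" using h_ge \<kappa> T by (smt (verit) mult_pos_pos)
  have F_le: "F \<le> cmod g + d * T"
    unfolding F_def using close norm_triangle_ineq2[of f g] by (simp add: norm_minus_commute)
  have hf: "cmod (h - f) \<le> e * T"
  proof (cases "cmod g \<ge> \<kappa> * T")
    case True
    have "cmod (h - f) \<le> d * T" using close True by (simp add: h_def)
    also have "\<dots> \<le> e * T" using \<kappa> T by (intro mult_right_mono) (auto simp: e_def)
    finally show ?thesis .
  next
    case False
    \<comment> \<open>A small \<open>g\<close> forces a small \<open>f\<close>, so replacing \<open>g\<close> by \<open>\<kappa> T\<close> costs only \<open>O(T)\<close>.\<close>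
    have "cmod (h - f) \<le> \<kappa> * T + F"
      using False \<kappa> T norm_triangle_ineq4[of "complex_of_real (\<kappa> * T)" f]
      unfolding F_def h_def by (simp add: norm_mult)
    also have "\<dots> \<le> \<kappa> * T + (\<kappa> * T + d * T)" using F_le False by linarith
    finally show ?thesis by (simp add: e_def algebra_simps)
  qed
  define x where "x = cmod (h - f) / cmod h"
  have x0: "x \<ge> 0" by (simp add: x_def)
  have "cmod (1 / h - 1 / f) = cmod ((f - h) / (h * f))"
    using h f by (simp add: field_simps)
  then have x: "cmod (1 / h - 1 / f) = x / F"
    by (simp add: x_def F_def norm_divide norm_mult norm_minus_commute)
  have x_le: "x \<le> e / \<kappa>"
  proof -
    have "x \<le> (e * T) / (\<kappa> * T)"
      unfolding x_def using hf h_ge \<kappa> T e by (intro frac_le) auto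
    then show ?thesis using T by simp
  qed
  have xF_le: "x * F / T \<le> e * (1 + e / \<kappa>)"
  proof -
    have "F \<le> cmod h + cmod (h - f)"
      unfolding F_def using norm_triangle_ineq4[of h "h - f"] by simp
    then have "F / cmod h \<le> (cmod h + cmod (h - f)) / cmod h"
      using h by (simp add: divide_right_mono)
    also have "\<dots> = 1 + x" using h by (simp add: x_def add_divide_distrib)
    also have "\<dots> \<le> 1 + e / \<kappa>" using x_le by simp
    finally have 1: "F / cmod h \<le> 1 + e / \<kappa>" .
    have 2: "cmod (h - f) / T \<le> e" using hf T by (simp add: pos_divide_le_eq)
    have "x * F / T = (cmod (h - f) / T) * (F / cmod h)" by (simp add: x_def)
    also have "\<dots> \<le> e * (1 + e / \<kappa>)"
      using 1 2 F h e by (intro mult_mono) auto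
    finally show ?thesis .
  qed
  have e_le: "e \<le> b * q"
  proof -
    have "b * q = e + 1 + 2 * \<kappa> * d" by (simp add: b_def q_def e_def algebra_simps)
    then show ?thesis using \<kappa> d by simp
  qed
  have q1: "q\<^sup>2 \<le> q ^ 4" using q by (intro power_increasing) auto
  have "x\<^sup>2 \<le> (b / \<kappa>)\<^sup>2 * q ^ 4"
  proof -
    have "x \<le> b / \<kappa> * q"
      using x_le e_le \<kappa> by (smt (verit) divide_right_mono times_divide_eq_left)
    then have "x\<^sup>2 \<le> (b / \<kappa> * q)\<^sup>2" using x0 by (intro power_mono)
    also have "\<dots> \<le> (b / \<kappa>)\<^sup>2 * q ^ 4"
      unfolding power_mult_distrib using q1 by (intro mult_left_mono) auto
    finally show ?thesis .
  qed
  moreover have "(x * F / T)\<^sup>2 \<le> (b\<^sup>2 * (1 + b / \<kappa>)\<^sup>2) * q ^ 4"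
  proof -
    have "1 + e / \<kappa> \<le> q * (1 + b / \<kappa>)"
    proof -
      have "e / \<kappa> \<le> b * q / \<kappa>" using e_le \<kappa> by (simp add: divide_right_mono)
      then show ?thesis using q by (simp add: algebra_simps)
    qed
    then have "e * (1 + e / \<kappa>) \<le> (b * q) * (q * (1 + b / \<kappa>))"
      using e_le b q e \<kappa> by (intro mult_mono) auto
    then have "x * F / T \<le> b * (1 + b / \<kappa>) * q\<^sup>2"
      using xF_le by (simp add: power2_eq_square mult_ac)
    then have "(x * F / T)\<^sup>2 \<le> (b * (1 + b / \<kappa>) * q\<^sup>2)\<^sup>2"
      using x0 F T by (intro power_mono) auto
    then show ?thesis by (simp add: power_mult_distrib flip: power_mult)
  qed
  ultimately have le: "max ((x * F / T)\<^sup>2) (x\<^sup>2)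
      \<le> ((b / \<kappa>)\<^sup>2 + b\<^sup>2 * (1 + b / \<kappa>)\<^sup>2) * q ^ 4"
    unfolding distrib_right by (smt (verit) zero_le_power2)
  have "(x / F)\<^sup>2 / min (T\<^sup>2 / F ^ 4) (1 / F\<^sup>2) \<le> max ((x * F / T)\<^sup>2) (x\<^sup>2)"
  proof -
    have "(x / F)\<^sup>2 / (T\<^sup>2 / F ^ 4) = (x * F / T)\<^sup>2"
      using F T by (simp add: field_simps power4_eq_xxxx power2_eq_square)
    moreover have "(x / F)\<^sup>2 / (1 / F\<^sup>2) = x\<^sup>2"
      using F by (simp add: field_simps power2_eq_square)
    ultimately show ?thesis by (simp add: min_def)
  qed
  then show ?thesis using le unfolding x b_def[symmetric] q_def[symmetric] F_def[symmetric]
    by linarith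
qed

section \<open>Moments from the characteristic exponent\<close>

lemma norm_iexp_minus_one_le: "cmod (iexp x - 1) \<le> \<bar>x\<bar>"
  using iexp_approx1[of x 0] by simp

lemma one_minus_Re_char:
  assumes "real_distribution P"
  shows "1 - Re (char P u) = (\<integral>x. 1 - cos (u * x) \<partial>P)"
proof -
  interpret real_distribution P by fact
  have "integrable P (\<lambda>x. iexp (u * x))"
    by (rule integrable_const_bound[of _ 1]) auto
  then have "Re (char P u) = (\<integral>x. Re (iexp (u * x)) \<partial>P)"
    unfolding char_def by (rule integral_Re[symmetric])
  also have "\<dots> = (\<integral>x. cos (u * x) \<partial>P)" by (simp add: Re_exp)
  finally have *: "Re (char P u) = (\<integral>x. cos (u * x) \<partial>P)" .
  have "integrable P (\<lambda>x. cos (u * x))"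
    by (rule integrable_const_bound[of _ 1]) auto
  then show ?thesis
    unfolding * by (simp del: space_eq_univ add: prob_space)
qed

text \<open>
  The functions \<open>2 (1 - cos (t x)) / t\<^sup>2\<close> converge to \<open>x\<^sup>2\<close> as \<open>t\<close> tends to \<open>0\<close>, and their integrals
  are at most \<open>2 K\<close>; Fatou's lemma, along \<open>t = 1 / (k + 1)\<close>, finishes the argument.
\<close>

lemma second_moment_of_char_bound:
  assumes P: "real_distribution P" and K: "\<And>u. 1 - Re (char P u) \<le> K * u\<^sup>2"
  shows "integrable P (\<lambda>x. x\<^sup>2)"
proof -
  interpret real_distribution P by fact
  define g where "g = (\<lambda>(k::nat) x::real. 2 * (real (Suc k))\<^sup>2 * (1 - cos (inverse (real (Suc k)) * x)))"
  have lim: "(\<lambda>k. g k x) \<longlonglongrightarrow> x\<^sup>2" for x :: real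
  proof -
    have sin: "((\<lambda>t::real. sin t / t) \<longlongrightarrow> 1) (at 0)"
      using DERIV_sin[of "0::real"] by (simp add: DERIV_def)
    show ?thesis
    proof (cases "x = 0")
      case True then show ?thesis by (simp add: g_def)
    next
      case False
      have *: "filterlim (\<lambda>k. inverse (real (Suc k)) * (x / 2)) (at 0) sequentially"
        unfolding filterlim_at
      proof
        have "(\<lambda>k. inverse (real (Suc k)) * (x / 2)) \<longlonglongrightarrow> 0 * (x / 2)"
          by (intro tendsto_mult LIMSEQ_inverse_real_of_nat tendsto_const)
        then show "(\<lambda>k. inverse (real (Suc k)) * (x / 2)) \<longlonglongrightarrow> 0" by simp
      qed (use False in auto)
      have "(\<lambda>k. (sin (inverse (real (Suc k)) * (x / 2)) / (inverse (real (Suc k)) * (x / 2)))\<^sup>2 * x\<^sup>2)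
          \<longlonglongrightarrow> 1\<^sup>2 * x\<^sup>2"
        by (intro tendsto_mult tendsto_power tendsto_const filterlim_compose[OF sin *])
      moreover have "g k x = (sin (inverse (real (Suc k)) * (x / 2)) / (inverse (real (Suc k)) * (x / 2)))\<^sup>2 * x\<^sup>2" for k
      proof -
        have "1 - cos (inverse (real (Suc k)) * x) = 2 * (sin (inverse (real (Suc k)) * (x / 2)))\<^sup>2"
          using cos_double_sin[of "inverse (real (Suc k)) * (x / 2)"] by simp
        then show ?thesis using False unfolding g_def
          by (simp only: power_divide power_mult_distrib power_inverse) (simp add: divide_simps del: of_nat_Suc)
      qed
      ultimately show ?thesis by simp
    qed
  qed
  have g0: "g k x \<ge> 0" for k x by (simp add: g_def)
  have bound: "(\<integral>\<^sup>+x. ennreal (g k x) \<partial>P) \<le> ennreal (2 * K)" for k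
  proof -
    have "integrable P (g k)"
      unfolding g_def
      by (intro integrable_mult_right Bochner_Integration.integrable_diff integrable_const
          integrable_const_bound[of _ 1]) auto
    then have "(\<integral>\<^sup>+x. ennreal (g k x) \<partial>P) = ennreal (\<integral>x. g k x \<partial>P)"
      using g0 by (intro nn_integral_eq_integral) auto
    also have "(\<integral>x. g k x \<partial>P) = 2 * (real (Suc k))\<^sup>2 * (1 - Re (char P (inverse (real (Suc k)))))"
      unfolding g_def one_minus_Re_char[OF P] by simp
    also have "\<dots> \<le> 2 * (real (Suc k))\<^sup>2 * (K * (inverse (real (Suc k)))\<^sup>2)"
      by (intro mult_left_mono K) auto
    also have "\<dots> = 2 * K" by (simp add: power_inverse)
    finally show ?thesis by (simp add: ennreal_leI)
  qed
  have "(\<integral>\<^sup>+x. ennreal (x\<^sup>2) \<partial>P) = (\<integral>\<^sup>+x. liminf (\<lambda>k. ennreal (g k x)) \<partial>P)"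
    by (intro nn_integral_cong lim_imp_Liminf[symmetric] tendsto_ennrealI lim) auto
  also have "\<dots> \<le> liminf (\<lambda>k. \<integral>\<^sup>+x. ennreal (g k x) \<partial>P)"
    by (intro nn_integral_liminf) (simp add: g_def)
  also have "\<dots> \<le> ennreal (2 * K)"
    by (rule Liminf_le) (use bound in \<open>auto intro: always_eventually\<close>)
  finally have "(\<integral>\<^sup>+x. ennreal (x\<^sup>2) \<partial>P) < \<infinity>"
    by (rule le_less_trans) simp
  then show ?thesis
    by (intro integrableI_bounded) auto
qed

lemma one_minus_cos_le: "1 - cos x \<le> x\<^sup>2" for x :: real
proof -
  have "1 - cos x = 2 * (sin (x / 2))\<^sup>2"
    using cos_double_sin[of "x / 2"] by simp
  also have "\<dots> \<le> 2 * (x / 2)\<^sup>2"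
    using abs_sin_x_le_abs_x[of "x / 2"]
    by (intro mult_left_mono) (simp_all only: abs_le_square_iff zero_le_numeral)
  also have "\<dots> \<le> x\<^sup>2" by (simp add: power_divide)
  finally show ?thesis .
qed

text \<open>
  For \<open>\<psi> = r + i t\<close> with \<open>r \<le> 0\<close>, one has \<open>1 - Re (exp \<psi>) \<le> -r + t\<^sup>2\<close>.  Hence the real part of the exponent
  must be \<open>O(u\<^sup>2)\<close>, which uses the second moment of \<open>\<nu>\<close>, while \<open>O(u)\<close> suffices for the imaginary part.
  The function \<open>g\<close> in the proof majorises \<open>\<bar>x\<bar>\<close>: the summability of the small jumps takes care
  of \<open>[-1, 1]\<close> and \<open>x\<^sup>2\<close> of the rest.
\<close>

lemma Re_exp_levy_exponent_bound:
  assumes \<nu>: "levy_measure \<nu>"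
    and small: "set_integrable \<nu> {-1..1} (\<lambda>x. \<bar>x\<bar>)"
    and sq: "integrable \<nu> (\<lambda>x. x\<^sup>2)"
  shows "\<exists>K. \<forall>u. 1 - Re (exp (levy_exponent b 0 \<nu> u)) \<le> K * u\<^sup>2"
proof -
  have [measurable_cong]: "sets \<nu> = sets borel" using \<nu> by (simp add: levy_measure_def)
  define g where "g = (\<lambda>x::real. indicator {-1..1} x * \<bar>x\<bar> + x\<^sup>2)"
  have g: "integrable \<nu> g"
    using small sq unfolding g_def set_integrable_def by (intro Bochner_Integration.integrable_add) auto
  have abs_le_g: "\<bar>x\<bar> \<le> g x" for x
  proof (cases "\<bar>x\<bar> \<le> 1")
    case True then show ?thesis by (auto simp: g_def indicator_def)
  next
    case False
    then have "\<bar>x\<bar> * 1 \<le> \<bar>x\<bar> * \<bar>x\<bar>" by (intro mult_left_mono) auto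
    then show ?thesis by (auto simp: g_def indicator_def power2_eq_square)
  qed
  define F where "F = (\<lambda>u x. iexp (u * x) - 1 - \<i> * complex_of_real (u * x * indicator {-1..1} x))"
  define \<psi> where "\<psi> = (\<lambda>u. levy_exponent b 0 \<nu> u)"
  have \<psi>: "\<psi> u = \<i> * complex_of_real (b * u) + (LINT x|\<nu>. F u x)" for u
    by (simp add: \<psi>_def levy_exponent_def F_def)
  have F_le: "cmod (F u x) \<le> 2 * \<bar>u\<bar> * g x" for u x
  proof -
    have "cmod (F u x) \<le> cmod (iexp (u * x) - 1) + cmod (\<i> * complex_of_real (u * x * indicator {-1..1} x))"
      unfolding F_def by (rule norm_triangle_ineq4)
    also have "\<dots> \<le> \<bar>u * x\<bar> + \<bar>u * x\<bar>"
      by (intro add_mono norm_iexp_minus_one_le) (auto simp: norm_mult indicator_def)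
    also have "\<dots> = 2 * \<bar>u\<bar> * \<bar>x\<bar>" by (simp add: abs_mult)
    also have "\<dots> \<le> 2 * \<bar>u\<bar> * g x" by (intro mult_left_mono abs_le_g) auto
    finally show ?thesis .
  qed
  have F: "integrable \<nu> (F u)" for u
  proof (rule Bochner_Integration.integrable_bound)
    show "integrable \<nu> (\<lambda>x. 2 * \<bar>u\<bar> * g x)" using g by simp
    show "F u \<in> borel_measurable \<nu>" unfolding F_def by measurable
    show "AE x in \<nu>. norm (F u x) \<le> norm (2 * \<bar>u\<bar> * g x)"
      using F_le by (auto intro!: always_eventually order.trans[OF _ abs_ge_self])
  qed
  define S where "S = (\<integral>x. x\<^sup>2 \<partial>\<nu>)"
  define G where "G = (\<integral>x. 2 * g x \<partial>\<nu>)"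
  have Re: "- Re (\<psi> u) \<le> u\<^sup>2 * S" for u
  proof -
    have "- Re (\<psi> u) = (\<integral>x. - Re (F u x) \<partial>\<nu>)"
      using integral_Re[OF F[of u]] by (simp add: \<psi>)
    also have "\<dots> \<le> (\<integral>x. u\<^sup>2 * x\<^sup>2 \<partial>\<nu>)"
    proof (intro integral_mono)
      fix x
      show "- Re (F u x) \<le> u\<^sup>2 * x\<^sup>2"
        using one_minus_cos_le[of "u * x"] by (simp add: F_def Re_exp power_mult_distrib)
    qed (use F sq in \<open>auto intro: integrable_Re\<close>)
    finally show ?thesis by (simp add: S_def)
  qed
  have Re0: "Re (\<psi> u) \<le> 0" for u
  proof -
    have "0 \<le> (\<integral>x. - Re (F u x) \<partial>\<nu>)"
      by (rule Bochner_Integration.integral_nonneg) (simp add: F_def Re_exp)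
    also have "\<dots> = - Re (\<psi> u)"
      using integral_Re[OF F[of u]] by (simp add: \<psi>)
    finally show ?thesis by simp
  qed
  have Im: "\<bar>Im (\<psi> u)\<bar> \<le> \<bar>u\<bar> * (\<bar>b\<bar> + G)" for u
  proof -
    have "\<bar>Im (\<psi> u)\<bar> \<le> cmod (\<psi> u)" by (rule abs_Im_le_cmod)
    also have "\<dots> \<le> \<bar>b * u\<bar> + cmod (LINT x|\<nu>. F u x)"
      unfolding \<psi> by (rule order.trans[OF norm_triangle_ineq]) (simp add: norm_mult abs_mult)
    also have "cmod (LINT x|\<nu>. F u x) \<le> (LINT x|\<nu>. \<bar>u\<bar> * (2 * g x))"
      by (rule Bochner_Integration.integral_norm_bound_integral) (use F g F_le in \<open>auto simp: mult_ac\<close>)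
    finally show ?thesis by (simp add: G_def abs_mult algebra_simps)
  qed
  have "1 - Re (exp (\<psi> u)) \<le> (S + (\<bar>b\<bar> + G)\<^sup>2) * u\<^sup>2" for u
  proof -
    define r where "r = Re (\<psi> u)"
    define t where "t = Im (\<psi> u)"
    have r: "r \<le> 0" "exp r \<le> 1" using Re0[of u] by (auto simp: r_def)
    have "1 - Re (exp (\<psi> u)) = (1 - exp r) + exp r * (1 - cos t)"
      by (simp add: Re_exp r_def t_def algebra_simps)
    also have "exp r * (1 - cos t) \<le> 1 * (1 - cos t)"
      using r by (intro mult_right_mono) auto
    also have "1 * (1 - cos t) \<le> \<bar>t\<bar>\<^sup>2" using one_minus_cos_le[of t] by simp
    also have "\<bar>t\<bar>\<^sup>2 \<le> (\<bar>u\<bar> * (\<bar>b\<bar> + G))\<^sup>2"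
      using Im[of u] by (intro power_mono) (auto simp: t_def)
    also have "(\<bar>u\<bar> * (\<bar>b\<bar> + G))\<^sup>2 = (\<bar>b\<bar> + G)\<^sup>2 * u\<^sup>2" by (simp add: power_mult_distrib)
    also have "1 - exp r \<le> - r" using exp_ge_add_one_self[of r] by linarith
    also have "- r \<le> u\<^sup>2 * S" using Re[of u] by (simp add: r_def)
    finally show ?thesis unfolding distrib_right by (simp add: mult.commute)
  qed
  then show ?thesis unfolding \<psi>_def by blast
qed

section \<open>The uniform deviation of the empirical characteristic function\<close>

lemma norm_iexp_diff_le: "cmod (iexp a - iexp b) \<le> \<bar>a - b\<bar>"
proof -
  have "iexp a - iexp b = iexp b * (iexp (a - b) - 1)"
    by (simp add: algebra_simps flip: exp_add)
  then show ?thesis using norm_iexp_minus_one_le[of "a - b"] by (simp add: norm_mult)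
qed

lemma char_lipschitz:
  assumes "real_distribution Q" and int: "integrable Q (\<lambda>x. \<bar>x\<bar>)"
  shows "cmod (char Q u - char Q v) \<le> \<bar>u - v\<bar> * (\<integral>x. \<bar>x\<bar> \<partial>Q)"
proof -
  interpret real_distribution Q by fact
  have I: "integrable Q (\<lambda>x. iexp (u * x))" for u
    by (rule integrable_const_bound[of _ 1]) auto
  have "char Q u - char Q v = (\<integral>x. iexp (u * x) - iexp (v * x) \<partial>Q)"
    unfolding char_def by (rule Bochner_Integration.integral_diff[symmetric]) (rule I)+
  also have "cmod \<dots> \<le> (\<integral>x. \<bar>u - v\<bar> * \<bar>x\<bar> \<partial>Q)"
  proof (rule Bochner_Integration.integral_norm_bound_integral)
    fix x
    show "cmod (iexp (u * x) - iexp (v * x)) \<le> \<bar>u - v\<bar> * \<bar>x\<bar>"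
      using norm_iexp_diff_le[of "u * x" "v * x"] by (simp add: abs_mult flip: left_diff_distrib)
  qed (use I int in auto)
  finally show ?thesis by simp
qed

lemma one_le_ln_exp_plus: "ln (exp 1 + \<bar>u\<bar>) \<ge> (1::real)"
proof -
  have "ln (exp 1) \<le> ln (exp 1 + \<bar>u\<bar>)" by (subst ln_le_cancel_iff) (auto intro: add_pos_nonneg)
  then show ?thesis by simp
qed

lemma inverse_weight: "inverse (weight \<delta> u) = ln (exp 1 + \<bar>u\<bar>) powr (1 / 2 + \<delta>)"
  unfolding weight_def by (simp add: powr_minus[symmetric] add.commute)

lemma inverse_weight_mono:
  assumes "\<delta> > 0" "\<bar>u\<bar> \<le> \<bar>v\<bar>"
  shows "inverse (weight \<delta> u) \<le> inverse (weight \<delta> v)"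
  unfolding inverse_weight
proof (rule powr_mono2)
  show "ln (exp 1 + \<bar>u\<bar>) \<le> ln (exp 1 + \<bar>v\<bar>)"
    using assms(2) by (subst ln_le_cancel_iff) (auto intro: add_pos_nonneg)
qed (use assms(1) one_le_ln_exp_plus[of u] in auto)

lemma inverse_weight_ge:
  assumes "\<delta> > 0"
  shows "inverse (weight \<delta> u) \<ge> sqrt (ln (exp 1 + \<bar>u\<bar>))"
  unfolding inverse_weight powr_half_sqrt[symmetric]
  using assms one_le_ln_exp_plus[of u]
  by (subst powr_half_sqrt[symmetric]) (auto intro!: powr_mono)

lemma threshold_scale: "threshold \<kappa> \<delta> n u = \<kappa> * threshold 1 \<delta> n u"
  by (simp add: threshold_def)

lemma ln_nat_ge_half: "n \<ge> 2 \<Longrightarrow> ln (real n) \<ge> 1 / 2"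
proof -
  assume "n \<ge> 2"
  then have "ln 2 \<le> ln (real n)" by simp
  then show ?thesis using ln2_ge_two_thirds by linarith
qed

lemma threshold_mono:
  assumes "\<delta> > 0" "n \<ge> 2" "\<bar>u\<bar> \<le> \<bar>v\<bar>"
  shows "threshold 1 \<delta> n u \<le> threshold 1 \<delta> n v"
  unfolding threshold_def using inverse_weight_mono[OF assms(1,3)] assms(2)
  by (intro mult_right_mono mult_left_mono) auto

lemma threshold_ge:
  assumes "\<delta> > 0" "n \<ge> 2"
  shows "threshold 1 \<delta> n u \<ge> sqrt (ln (real n) * ln (exp 1 + \<bar>u\<bar>) / real n)"
proof -
  have "sqrt (ln (real n) * ln (exp 1 + \<bar>u\<bar>) / real n)
      = 1 * sqrt (ln (real n)) * sqrt (ln (exp 1 + \<bar>u\<bar>)) * inverse (sqrt (real n))"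
    by (simp add: real_sqrt_mult real_sqrt_inverse divide_inverse)
  also have "\<dots> \<le> threshold 1 \<delta> n u"
    unfolding threshold_def using inverse_weight_ge[OF assms(1)] assms(2)
    by (intro mult_right_mono mult_left_mono) auto
  finally show ?thesis .
qed

lemma threshold_ge_inverse:
  assumes "\<delta> > 0" "n \<ge> 2"
  shows "threshold 1 \<delta> n u \<ge> sqrt (1 / 2) / sqrt (real n)"
    and "threshold 1 \<delta> n u \<ge> 1 / real n"
proof -
  have "1 / 2 * 1 \<le> ln (real n) * ln (exp 1 + \<bar>u\<bar>)"
    using ln_nat_ge_half[OF assms(2)] one_le_ln_exp_plus[of u] by (intro mult_mono) auto
  then have *: "(1 / 2) / real n \<le> ln (real n) * ln (exp 1 + \<bar>u\<bar>) / real n"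
    by (intro divide_right_mono) auto
  then show "threshold 1 \<delta> n u \<ge> sqrt (1 / 2) / sqrt (real n)"
    using threshold_ge[OF assms, of u] real_sqrt_le_mono[OF *]
    unfolding real_sqrt_divide by linarith
  have "(1 / real n)\<^sup>2 \<le> (1 / 2) / real n"
    using assms(2) by (simp add: field_simps power2_eq_square)
  then have "1 / real n \<le> sqrt ((1 / 2) / real n)"
    by (rule real_le_rsqrt)
  then show "threshold 1 \<delta> n u \<ge> 1 / real n"
    using threshold_ge[OF assms, of u] real_sqrt_le_mono[OF *] by linarith
qed

text \<open>
  The empirical characteristic function depends on the process only through a sample of
  independent variables with a common law \<open>Q\<close>.  In each statement below that concerns a threshold,
  \<open>threshold 1 \<delta> n\<close> is the function \<open>T\<close> of the introduction.
\<close>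

locale iid_sample = prob_space M for M :: "'a measure" +
  fixes Z :: "nat \<Rightarrow> 'a \<Rightarrow> real" and Q :: "real measure"
  assumes indep: "indep_vars (\<lambda>_. borel) Z {1..n}"
    and distr: "k \<ge> 1 \<Longrightarrow> distr M borel (Z k) = Q"
    and moment: "integrable Q (\<lambda>x. \<bar>x\<bar>)"
begin

definition ecf :: "nat \<Rightarrow> real \<Rightarrow> 'a \<Rightarrow> complex" where
  "ecf n u \<omega> = (\<Sum>k=1..n. iexp (u * Z k \<omega>)) / of_nat n"

lemma Z_measurable [measurable]: "k \<in> {1..n} \<Longrightarrow> Z k \<in> borel_measurable M"
  using indep[of n] unfolding indep_vars_def by auto

lemma Z1_measurable [measurable]: "Z (Suc 0) \<in> borel_measurable M"
  by (rule Z_measurable[of _ 1]) auto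

lemma ecf_measurable [measurable]: "ecf n u \<in> borel_measurable M"
  unfolding ecf_def by (intro borel_measurable_divide borel_measurable_sum) auto

lemma real_distribution_Q: "real_distribution Q"
  using distr[of 1] Z1_measurable by (auto intro!: real_distribution_distr)

lemma norm_ecf_le: "cmod (ecf n u \<omega>) \<le> 1"
proof -
  have "cmod (\<Sum>k=1..n. iexp (u * Z k \<omega>)) \<le> (\<Sum>k=1..n. 1)"
    by (rule sum_norm_le) (simp flip: of_real_mult)
  then show ?thesis by (cases "n = 0") (auto simp: ecf_def norm_divide divide_le_eq_1)
qed

lemma ecf_uminus: "ecf n (- u) \<omega> = cnj (ecf n u \<omega>)"
  unfolding ecf_def by (simp add: exp_cnj)

lemma char_uminus: "char Q (- u) = cnj (char Q u)"
proof -
  have "iexp (- u * x) = cnj (iexp (u * x))" for x by (simp add: exp_cnj)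
  then show ?thesis unfolding char_def by (simp only: Bochner_Integration.integral_cnj)
qed

text \<open>Hoeffding's inequality, normalised for the real and the imaginary part of an average.\<close>

lemma bounded_mean_deviation:
  fixes f :: "real \<Rightarrow> real"
  assumes [measurable]: "f \<in> borel_measurable borel" and f: "\<And>x. \<bar>f x\<bar> \<le> 1"
    and n: "n \<ge> 1" and s: "s \<ge> 0"
  shows "prob {\<omega> \<in> space M. \<bar>(\<Sum>k=1..n. f (Z k \<omega>)) / real n - (\<integral>x. f x \<partial>Q)\<bar> \<ge> s}
    \<le> 2 * exp (- real n * s\<^sup>2 / 2)"
proof -
  interpret H: Hoeffding_ineq M "{1..n}" "\<lambda>k \<omega>. f (Z k \<omega>)" "\<lambda>_. -1" "\<lambda>_. 1"
    "\<Sum>k\<in>{1..n}. expectation (\<lambda>\<omega>. f (Z k \<omega>))"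
  proof unfold_locales
    show "indep_vars (\<lambda>_. borel) (\<lambda>k \<omega>. f (Z k \<omega>)) {1..n}"
      by (rule indep_vars_compose2[OF indep]) auto
    show "AE x in M. f (Z i x) \<in> {- 1..1}" for i
      using f by (auto simp: abs_le_iff minus_le_iff)
  qed auto
  have E: "expectation (\<lambda>\<omega>. f (Z k \<omega>)) = (\<integral>x. f x \<partial>Q)" if "k \<in> {1..n}" for k
    using that distr[of k] by (subst integral_distr[symmetric, of "Z k" M borel f]) auto
  have "prob {\<omega> \<in> space M. \<bar>(\<Sum>k=1..n. f (Z k \<omega>)) - real n * (\<integral>x. f x \<partial>Q)\<bar> \<ge> real n * s}
      \<le> 2 * exp (- 2 * (real n * s)\<^sup>2 / (\<Sum>k\<in>{1..n}. (1 - (-1))\<^sup>2))"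
    using H.Hoeffding_ineq_abs_ge[of "real n * s"] s n E by simp
  also have "- 2 * (real n * s)\<^sup>2 / (\<Sum>k\<in>{1..n}. (1 - (-1))\<^sup>2) = - real n * s\<^sup>2 / 2"
    using n by (simp add: power2_eq_square field_simps)
  also have "{\<omega> \<in> space M. \<bar>(\<Sum>k=1..n. f (Z k \<omega>)) - real n * (\<integral>x. f x \<partial>Q)\<bar> \<ge> real n * s}
      = {\<omega> \<in> space M. \<bar>(\<Sum>k=1..n. f (Z k \<omega>)) / real n - (\<integral>x. f x \<partial>Q)\<bar> \<ge> s}"
  proof -
    have "\<bar>a - real n * c\<bar> \<ge> real n * s \<longleftrightarrow> \<bar>a / real n - c\<bar> \<ge> s" for a c
    proof -
      have "\<bar>a - real n * c\<bar> = real n * \<bar>a / real n - c\<bar>"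
        using n abs_mult[of "real n" "a / real n - c"] by (simp add: right_diff_distrib)
      then show ?thesis using n by simp
    qed
    then show ?thesis by simp
  qed
  finally show ?thesis .
qed

lemma ecf_deviation:
  assumes n: "n \<ge> 1" and s: "s \<ge> 0"
  shows "prob {\<omega> \<in> space M. cmod (ecf n u \<omega> - char Q u) \<ge> s} \<le> 4 * exp (- real n * s\<^sup>2 / 8)"
proof -
  interpret Q: real_distribution Q by (rule real_distribution_Q)
  have I: "integrable Q (\<lambda>x. iexp (u * x))"
    by (rule Q.integrable_const_bound[of _ 1]) auto
  have Re: "Re (ecf n u \<omega> - char Q u) = (\<Sum>k=1..n. cos (u * Z k \<omega>)) / real n - (\<integral>x. cos (u * x) \<partial>Q)" for \<omega>
    using integral_Re[OF I] by (simp add: ecf_def char_def Re_exp Re_divide_of_nat)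
  have Im: "Im (ecf n u \<omega> - char Q u) = (\<Sum>k=1..n. sin (u * Z k \<omega>)) / real n - (\<integral>x. sin (u * x) \<partial>Q)" for \<omega>
    using integral_Im[OF I] by (simp add: ecf_def char_def Im_exp Im_divide_of_nat)
  let ?R = "{\<omega> \<in> space M. \<bar>Re (ecf n u \<omega> - char Q u)\<bar> \<ge> s / 2}"
  let ?I = "{\<omega> \<in> space M. \<bar>Im (ecf n u \<omega> - char Q u)\<bar> \<ge> s / 2}"
  have "prob {\<omega> \<in> space M. cmod (ecf n u \<omega> - char Q u) \<ge> s} \<le> prob (?R \<union> ?I)"
  proof (rule finite_measure_mono)
    show "{\<omega> \<in> space M. cmod (ecf n u \<omega> - char Q u) \<ge> s} \<subseteq> ?R \<union> ?I"
    proof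
      fix \<omega> assume \<omega>: "\<omega> \<in> {\<omega> \<in> space M. cmod (ecf n u \<omega> - char Q u) \<ge> s}"
      then show "\<omega> \<in> ?R \<union> ?I" using cmod_le[of "ecf n u \<omega> - char Q u"] by auto
    qed
  qed measurable
  also have "\<dots> \<le> prob ?R + prob ?I" by (rule measure_Un_le) measurable
  also have "\<dots> \<le> 2 * exp (- real n * (s / 2)\<^sup>2 / 2) + 2 * exp (- real n * (s / 2)\<^sup>2 / 2)"
    unfolding Re Im using n s by (intro add_mono bounded_mean_deviation) auto
  finally show ?thesis by (simp add: power_divide)
qed

text \<open>
  The mesh \<open>n^(-3)\<close> is chosen so that a Lipschitz constant of order \<open>n\<^sup>2\<close> costs only \<open>1 / n \<le> T\<close> between
  neighbouring nodes.  By conjugation symmetry it is enough to have nodes on the half line.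
\<close>

definition node :: "nat \<Rightarrow> nat \<Rightarrow> real" where "node n j = real j / real n ^ 3"

text \<open>
  The constant \<open>12\<close> makes the exponent \<open>n (12 T)\<^sup>2 / 8\<close> of the tail bound at least
  \<open>18 ln n ln (e + u)\<close>.  This beats \<open>8 ln n + 2 ln (e + u)\<close>: the square of \<open>e + u\<close> is what makes the bounds
  summable over the nodes, six powers of \<open>n\<close> pay for the density of the nodes, and two
  remain for the probability of the event.
\<close>

definition exceptional :: "real \<Rightarrow> nat \<Rightarrow> 'a set" where
  "exceptional \<delta> n =
     (\<Union>j. {\<omega> \<in> space M. cmod (ecf n (node n j) \<omega> - char Q (node n j)) \<ge> 12 * threshold 1 \<delta> n (node n j)})
     \<union> {\<omega> \<in> space M. (\<Sum>k=1..n. \<bar>Z k \<omega>\<bar>) \<ge> real n ^ 3}"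

lemma sum_abs_measurable [measurable]: "(\<lambda>\<omega>. \<Sum>k=1..n. \<bar>Z k \<omega>\<bar>) \<in> borel_measurable M"
  by (intro borel_measurable_sum) auto

lemma exceptional_sets [measurable]: "exceptional \<delta> n \<in> sets M"
  unfolding exceptional_def by measurable

text \<open>
  The logarithmic growth of the inverse weight turns the Gaussian tail into a power of
  \<open>e + u\<close>, and \<open>e + node n j \<ge> (j + 1) / n ^ 3\<close> converts it into a summable sequence in \<open>j\<close>.
\<close>

lemma node_deviation:
  assumes \<delta>: "\<delta> > 0" and n: "n \<ge> 2"
  shows "prob {\<omega> \<in> space M. cmod (ecf n (node n j) \<omega> - char Q (node n j)) \<ge> 12 * threshold 1 \<delta> n (node n j)}
    \<le> 4 / (real n)\<^sup>2 * (1 / (real j + 1)\<^sup>2)"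
proof -
  define v where "v = node n j"
  define T where "T = threshold 1 \<delta> n v"
  define x where "x = ln (real n)"
  define y where "y = ln (exp 1 + \<bar>v\<bar>)"
  have x: "x \<ge> 1 / 2" unfolding x_def by (rule ln_nat_ge_half[OF n])
  have y: "y \<ge> 1" unfolding y_def by (rule one_le_ln_exp_plus)
  have v: "v \<ge> 0" by (simp add: v_def node_def)
  have T: "T \<ge> 0" using threshold_ge_inverse(2)[OF \<delta> n, of v] by (auto simp: T_def intro: order.trans[rotated])
  have "real n * (12 * T)\<^sup>2 / 8 \<ge> 18 * (x * y)"
  proof -
    have "sqrt (x * y / real n) \<le> T" unfolding T_def x_def y_def by (rule threshold_ge[OF \<delta> n])
    then have "x * y / real n \<le> T\<^sup>2"
      using T by (metis real_sqrt_le_iff real_sqrt_abs abs_of_nonneg)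
    then show ?thesis using n by (simp add: field_simps power_mult_distrib)
  qed
  moreover have "8 * x + 2 * y \<le> 18 * (x * y)"
  proof -
    have "8 * x * 1 \<le> 8 * x * y" using x y by (intro mult_left_mono) auto
    moreover have "10 * (1 / 2) * y \<le> 10 * x * y" using x y by (intro mult_right_mono) auto
    ultimately show ?thesis using y by linarith
  qed
  ultimately have le: "- real n * (12 * T)\<^sup>2 / 8 \<le> - (8 * x) + - (2 * y)" by linarith
  have "prob {\<omega> \<in> space M. cmod (ecf n v \<omega> - char Q v) \<ge> 12 * T} \<le> 4 * exp (- real n * (12 * T)\<^sup>2 / 8)"
    using T n by (intro ecf_deviation) auto
  also have "\<dots> \<le> 4 * (exp (- (8 * x)) * exp (- (2 * y)))"
    using le by (simp flip: exp_add)
  also have "exp (- (8 * x)) = 1 / real n ^ 8"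
    using n exp_of_nat_mult[of 8 x] by (simp add: x_def exp_minus inverse_eq_divide)
  also have "exp (- (2 * y)) = 1 / (exp 1 + v)\<^sup>2"
    using v exp_of_nat_mult[of 2 y] add_pos_nonneg[of "exp 1" v]
    by (simp add: y_def exp_minus inverse_eq_divide)
  also have "4 * (1 / real n ^ 8 * (1 / (exp 1 + v)\<^sup>2))
      \<le> 4 * (1 / real n ^ 8 * (1 / ((real j + 1) / real n ^ 3)\<^sup>2))"
  proof (intro mult_left_mono divide_left_mono power_mono mult_pos_pos zero_less_power)
    have "1 \<le> real n ^ 3" using n by simp
    then have "1 / real n ^ 3 \<le> 1" using n by (subst divide_le_eq_1_pos) auto
    also have "1 \<le> exp (1::real)" by simp
    finally show "(real j + 1) / real n ^ 3 \<le> exp 1 + v"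
      by (simp add: v_def node_def add_divide_distrib)
  qed (use n v in \<open>auto intro: add_pos_nonneg\<close>)
  also have "\<dots> = 4 / (real n)\<^sup>2 * (1 / (real j + 1)\<^sup>2)"
  proof -
    have "real n ^ 8 = (real n)\<^sup>2 * real n ^ 6" by (simp flip: power_add)
    then show ?thesis using n by (simp add: power_divide field_simps)
  qed
  finally show ?thesis unfolding v_def T_def .
qed

lemma prob_exceptional:
  assumes \<delta>: "\<delta> > 0" and n: "n \<ge> 2"
  shows "prob (exceptional \<delta> n) \<le> (4 * (pi\<^sup>2 / 6) + (\<integral>x. \<bar>x\<bar> \<partial>Q)) / (real n)\<^sup>2"
proof -
  let ?A = "\<lambda>j. {\<omega> \<in> space M. cmod (ecf n (node n j) \<omega> - char Q (node n j)) \<ge> 12 * threshold 1 \<delta> n (node n j)}"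
  let ?B = "{\<omega> \<in> space M. (\<Sum>k=1..n. \<bar>Z k \<omega>\<bar>) \<ge> real n ^ 3}"
  have sums: "(\<lambda>j. 4 / (real n)\<^sup>2 * (1 / (real j + 1)\<^sup>2)) sums (4 / (real n)\<^sup>2 * (pi\<^sup>2 / 6))"
    by (intro sums_mult) (use inverse_squares_sums in \<open>simp add: add.commute\<close>)
  have summ: "summable (\<lambda>j. prob (?A j))"
    by (rule summable_comparison_test'[OF sums_summable[OF sums], of 0])
      (use node_deviation[OF \<delta> n] in auto)
  have "prob (\<Union>j. ?A j) \<le> (\<Sum>j. prob (?A j))"
    by (rule finite_measure_subadditive_countably) (use summ in auto)
  also have "\<dots> \<le> (\<Sum>j. 4 / (real n)\<^sup>2 * (1 / (real j + 1)\<^sup>2))"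
    by (intro suminf_le node_deviation[OF \<delta> n] summ sums_summable[OF sums])
  also have "\<dots> = 4 / (real n)\<^sup>2 * (pi\<^sup>2 / 6)" using sums by (simp add: sums_iff)
  finally have A: "prob (\<Union>j. ?A j) \<le> 4 / (real n)\<^sup>2 * (pi\<^sup>2 / 6)" .
  have I: "integrable M (\<lambda>\<omega>. \<bar>Z k \<omega>\<bar>)" "expectation (\<lambda>\<omega>. \<bar>Z k \<omega>\<bar>) = (\<integral>x. \<bar>x\<bar> \<partial>Q)" if "k \<in> {1..n}" for k
  proof -
    have [measurable]: "Z k \<in> borel_measurable M" by (rule Z_measurable[OF that])
    have eq: "distr M borel (Z k) = Q" using that distr[of k] by simp
    show "integrable M (\<lambda>\<omega>. \<bar>Z k \<omega>\<bar>)"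
      using moment unfolding eq[symmetric] by (subst (asm) integrable_distr_eq) auto
    show "expectation (\<lambda>\<omega>. \<bar>Z k \<omega>\<bar>) = (\<integral>x. \<bar>x\<bar> \<partial>Q)"
      unfolding eq[symmetric] by (subst integral_distr) auto
  qed
  have "prob ?B \<le> expectation (\<lambda>\<omega>. \<Sum>k=1..n. \<bar>Z k \<omega>\<bar>) / real n ^ 3"
    by (rule integral_Markov_inequality_measure[where A="{}"])
      (use I n in \<open>auto intro!: sum_nonneg\<close>)
  also have "expectation (\<lambda>\<omega>. \<Sum>k=1..n. \<bar>Z k \<omega>\<bar>) = real n * (\<integral>x. \<bar>x\<bar> \<partial>Q)"
    using I by (subst Bochner_Integration.integral_sum) auto
  also have "\<dots> / real n ^ 3 = (\<integral>x. \<bar>x\<bar> \<partial>Q) / (real n)\<^sup>2"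
    using n by (simp add: power2_eq_square power3_eq_cube)
  finally have B: "prob ?B \<le> (\<integral>x. \<bar>x\<bar> \<partial>Q) / (real n)\<^sup>2" .
  have "prob (exceptional \<delta> n) \<le> prob (\<Union>j. ?A j) + prob ?B"
    unfolding exceptional_def by (rule measure_Un_le) measurable
  also have "\<dots> \<le> 4 / (real n)\<^sup>2 * (pi\<^sup>2 / 6) + (\<integral>x. \<bar>x\<bar> \<partial>Q) / (real n)\<^sup>2"
    using A B by (rule add_mono)
  finally show ?thesis by (simp add: add_divide_distrib)
qed

text \<open>
  The point \<open>\<bar>u\<bar>\<close> is compared with the nearest node below it, because \<open>T\<close> increases in \<open>\<bar>u\<bar>\<close>
  and the bound at that node is therefore also a bound by \<open>T(u)\<close>.
\<close>

lemma uniform_deviation: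
  assumes \<delta>: "\<delta> > 0" and n: "n \<ge> 2" and \<omega>: "\<omega> \<in> space M - exceptional \<delta> n"
  shows "cmod (ecf n u \<omega> - char Q u) \<le> (13 + (\<integral>x. \<bar>x\<bar> \<partial>Q)) * threshold 1 \<delta> n u"
proof -
  define m where "m = (\<integral>x. \<bar>x\<bar> \<partial>Q)"
  have m: "m \<ge> 0" by (simp add: m_def)
  define D where "D = (\<lambda>v. ecf n v \<omega> - char Q v)"
  have "D (- v) = cnj (D v)" for v by (simp add: D_def ecf_uminus char_uminus)
  then have D_abs: "cmod (D u) = cmod (D \<bar>u\<bar>)" by (cases "u \<ge> 0") (auto simp: abs_if)
  define j where "j = nat \<lfloor>\<bar>u\<bar> * real n ^ 3\<rfloor>"
  have n3: "real n ^ 3 > 0" using n by simp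
  have j: "real j \<le> \<bar>u\<bar> * real n ^ 3" "\<bar>u\<bar> * real n ^ 3 \<le> real j + 1"
    unfolding j_def using n3 by (auto simp: of_nat_nat) 
  have node: "node n j \<le> \<bar>u\<bar>" "\<bar>u\<bar> - node n j \<le> 1 / real n ^ 3" "node n j \<ge> 0"
    using j n3 by (auto simp: node_def pos_divide_le_eq diff_le_eq add_divide_distrib[symmetric] pos_le_divide_eq add.commute)
  have sumZ: "(\<Sum>k=1..n. \<bar>Z k \<omega>\<bar>) \<le> real n ^ 3" using \<omega> by (auto simp: exceptional_def not_le)
  have "cmod (ecf n \<bar>u\<bar> \<omega> - ecf n (node n j) \<omega>) \<le> (\<bar>u\<bar> - node n j) * (real n)\<^sup>2"
  proof -
    have "cmod (\<Sum>k=1..n. iexp (\<bar>u\<bar> * Z k \<omega>) - iexp (node n j * Z k \<omega>))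
        \<le> (\<Sum>k=1..n. (\<bar>u\<bar> - node n j) * \<bar>Z k \<omega>\<bar>)"
    proof (rule sum_norm_le)
      fix k
      show "cmod (iexp (\<bar>u\<bar> * Z k \<omega>) - iexp (node n j * Z k \<omega>)) \<le> (\<bar>u\<bar> - node n j) * \<bar>Z k \<omega>\<bar>"
        using norm_iexp_diff_le[of "\<bar>u\<bar> * Z k \<omega>" "node n j * Z k \<omega>"] node(1)
        by (simp add: abs_mult flip: left_diff_distrib)
    qed
    also have "\<dots> \<le> (\<bar>u\<bar> - node n j) * real n ^ 3"
      unfolding sum_distrib_left[symmetric] using sumZ node by (intro mult_left_mono) auto
    finally have "cmod (\<Sum>k=1..n. iexp (\<bar>u\<bar> * Z k \<omega>) - iexp (node n j * Z k \<omega>)) / real n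
        \<le> (\<bar>u\<bar> - node n j) * real n ^ 3 / real n"
      by (intro divide_right_mono) auto
    then show ?thesis
      using n by (simp add: ecf_def sum_subtractf norm_divide power2_eq_square power3_eq_cube
          flip: diff_divide_distrib)
  qed
  moreover have "cmod (char Q \<bar>u\<bar> - char Q (node n j)) \<le> (\<bar>u\<bar> - node n j) * m"
    using char_lipschitz[OF real_distribution_Q moment, of "\<bar>u\<bar>" "node n j"] node(1) by (simp add: m_def)
  ultimately have "cmod (D \<bar>u\<bar> - D (node n j)) \<le> (\<bar>u\<bar> - node n j) * ((real n)\<^sup>2 + m)"
    unfolding D_def distrib_left
    using norm_triangle_ineq4[of "ecf n \<bar>u\<bar> \<omega> - ecf n (node n j) \<omega>" "char Q \<bar>u\<bar> - char Q (node n j)"]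
    by (simp add: algebra_simps)
  also have "\<dots> \<le> 1 / real n ^ 3 * ((real n)\<^sup>2 + m)"
    using node m by (intro mult_right_mono) auto
  also have "\<dots> \<le> 1 / real n ^ 3 * ((real n)\<^sup>2 + m * (real n)\<^sup>2)"
    using m n mult_left_mono[of 1 "(real n)\<^sup>2" m] by (intro mult_left_mono) auto
  also have "\<dots> = (1 + m) * (1 / real n)"
    using n by (simp add: field_simps power2_eq_square power3_eq_cube)
  also have "\<dots> \<le> (1 + m) * threshold 1 \<delta> n u"
    using threshold_ge_inverse(2)[OF \<delta> n, of u] m by (intro mult_left_mono) auto
  finally have "cmod (D \<bar>u\<bar> - D (node n j)) \<le> (1 + m) * threshold 1 \<delta> n u" .
  moreover have "cmod (D (node n j)) \<le> 12 * threshold 1 \<delta> n (node n j)"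
    using \<omega> by (auto simp: exceptional_def D_def not_le intro: less_imp_le)
  moreover have "threshold 1 \<delta> n (node n j) \<le> threshold 1 \<delta> n u"
    using node by (intro threshold_mono[OF \<delta> n]) auto
  moreover have "cmod (D \<bar>u\<bar>) \<le> cmod (D (node n j)) + cmod (D \<bar>u\<bar> - D (node n j))"
    using norm_triangle_ineq[of "D (node n j)" "D \<bar>u\<bar> - D (node n j)"] by simp
  ultimately have "cmod (D u) \<le> 12 * threshold 1 \<delta> n u + (1 + m) * threshold 1 \<delta> n u"
    using D_abs by linarith
  then show ?thesis by (simp add: D_def m_def algebra_simps)
qed

lemma trivial_deviation:
  assumes \<delta>: "\<delta> > 0" and n: "n \<ge> 2"
  shows "cmod (ecf n u \<omega> - char Q u) \<le> (3 * sqrt (real n)) * threshold 1 \<delta> n u"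
proof -
  interpret Q: real_distribution Q by (rule real_distribution_Q)
  have "cmod (ecf n u \<omega> - char Q u) \<le> 2"
    using norm_triangle_ineq4[of "ecf n u \<omega>" "char Q u"] norm_ecf_le[of n u \<omega>] Q.cmod_char_le_1[of u]
    by linarith
  also have "2 \<le> 3 * sqrt (1 / 2 :: real)"
  proof -
    have "2 / 3 \<le> sqrt (1 / 2 :: real)" by (rule real_le_rsqrt) (simp add: power2_eq_square)
    then show ?thesis by simp
  qed
  also have "\<dots> = (3 * sqrt (real n)) * (sqrt (1 / 2) / sqrt (real n))" using n by simp
  also have "\<dots> \<le> (3 * sqrt (real n)) * threshold 1 \<delta> n u"
    by (intro mult_left_mono threshold_ge_inverse[OF \<delta> n]) auto
  finally show ?thesis .
qed

end

section \<open>The bound\<close>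

text \<open>
  The function \<open>f\<close> may be a supremum over an uncountable set, whose measurability is unclear; the
  bound passes through a measurable step function above it.
\<close>

lemma (in prob_space) nn_integral_two_level_bound:
  assumes A [measurable]: "A \<in> sets M" and a: "a \<ge> 0" and b: "b \<ge> 0"
    and pA: "prob A * b \<le> c"
    and out: "\<And>\<omega>. \<omega> \<in> space M - A \<Longrightarrow> f \<omega> \<le> ennreal a"
    and ins: "\<And>\<omega>. \<omega> \<in> space M \<Longrightarrow> f \<omega> \<le> ennreal b"
  shows "(\<integral>\<^sup>+\<omega>. f \<omega> \<partial>M) \<le> ennreal (a + c)"
proof -
  have "(\<integral>\<^sup>+\<omega>. f \<omega> \<partial>M) \<le> (\<integral>\<^sup>+\<omega>. ennreal a + ennreal b * indicator A \<omega> \<partial>M)"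
  proof (rule nn_integral_mono)
    fix \<omega> assume "\<omega> \<in> space M"
    then show "f \<omega> \<le> ennreal a + ennreal b * indicator A \<omega>"
      using out[of \<omega>] ins[of \<omega>] by (cases "\<omega> \<in> A") (auto intro: add_increasing)
  qed
  also have "\<dots> = ennreal a + ennreal b * emeasure M A"
    by (simp add: nn_integral_add nn_integral_cmult_indicator emeasure_space_1)
  also have "\<dots> = ennreal (a + prob A * b)"
    using a b by (simp add: emeasure_eq_measure ennreal_plus ennreal_mult'' mult.commute)
  also have "\<dots> \<le> ennreal (a + c)" using pA by (intro ennreal_leI) auto
  finally show ?thesis .
qed

lemma increments_iid_sample:
  assumes X: "levy_process M X" and m: "integrable (distr M borel (X 1)) (\<lambda>x. \<bar>x\<bar>)"
  shows "iid_sample M (incr X) (distr M borel (X 1))"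
proof -
  interpret prob_space M using X by (simp add: levy_process_def)
  have ind: "indep_vars (\<lambda>_. borel) (\<lambda>k \<omega>. X (real k) \<omega> - X (real (k - 1)) \<omega>) {..<n}" for n
  proof -
    \<comment> \<open>The doubled time \<open>0\<close> in \<open>0, 0, 1, 2, ...\<close> shifts the increments so that they are numbered from \<open>1\<close>.\<close>
    have "mono (\<lambda>k::nat. real (k - 1))" by (auto simp: mono_def)
    then have "indep_vars (\<lambda>_. borel)
        (\<lambda>k \<omega>. X (real (Suc k - 1)) \<omega> - X (real (k - 1)) \<omega>) {..<n}"
      using X unfolding levy_process_def
      by (elim conjE, elim allE[of _ "\<lambda>k. real (k - 1)"]) auto
    then show ?thesis by simp
  qed
  have stat: "distr M borel (\<lambda>\<omega>. X (s + 1) \<omega> - X s \<omega>) = distr M borel (X 1)" if "s \<ge> 0" for s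
    using X that unfolding levy_process_def by auto
  show ?thesis
  proof unfold_locales
    fix n :: nat
    have eq: "incr X k = (\<lambda>\<omega>. X (real k) \<omega> - X (real (k - 1)) \<omega>)" if "k \<in> {1..n}" for k
      using that by (simp add: incr_def fun_eq_iff of_nat_diff)
    have "indep_vars (\<lambda>_. borel) (\<lambda>k \<omega>. X (real k) \<omega> - X (real (k - 1)) \<omega>) {1..n}"
      by (rule indep_vars_subset[OF ind[of "Suc n"]]) auto
    then show "indep_vars (\<lambda>_. borel) (incr X) {1..n}"
      using eq by (subst indep_vars_cong[OF refl eq refl]) auto
  next
    fix k :: nat assume "k \<ge> 1"
    then show "distr M borel (incr X k) = distr M borel (X 1)"
      using stat[of "real k - 1"] by (simp add: incr_def[abs_def])
  qed (rule m)
qed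

theorem lemma4p2:
  fixes M :: "'a measure" and X :: "real \<Rightarrow> 'a \<Rightarrow> real" and \<nu> :: "real measure"
    and \<gamma> \<kappa> \<delta> \<epsilon> c1 :: real
  assumes "pure_jump_driftless M X \<nu>"
    and "integrable \<nu> (\<lambda>x. \<bar>x\<bar>\<^sup>2)"
    and "\<delta> > 0" and "\<gamma> > 0"
    and "\<epsilon> > 0" and "talagrand_constant TYPE('a) \<epsilon> c1"
    and "\<kappa> \<ge> 2 * (sqrt (2 * c1) + \<gamma>)"
  shows "\<exists>C::real. \<forall>n\<ge>2.
    (\<integral>\<^sup>+ \<omega>. (SUP u::real. ennreal (
        (cmod (1 / phi_check \<kappa> \<delta> X n u \<omega> - 1 / phi M X u))\<^sup>2 /
        min (ln (real n) * (inverse (weight \<delta> u))\<^sup>2 * inverse (real n) / (cmod (phi M X u)) ^ 4)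
            (1 / (cmod (phi M X u))\<^sup>2))) \<partial>M) \<le> ennreal C"
proof -
  have levy: "levy_process M X" and small: "set_integrable \<nu> {-1..1} (\<lambda>x. \<bar>x\<bar>)"
    and trip: "has_levy_triplet M X (LINT x:{-1..1}|\<nu>. x) 0 \<nu>"
    using assms(1) by (auto simp: pure_jump_driftless_def)
  interpret prob_space M using levy by (simp add: levy_process_def)
  define Q where "Q = distr M borel (X 1)"
  define b where "b = (LINT x:{-1..1}|\<nu>. x)"
  have [measurable]: "X 1 \<in> borel_measurable M" using levy by (simp add: levy_process_def)
  have Q: "real_distribution Q" unfolding Q_def by (rule real_distribution_distr) simp
  have char_Q: "char Q u = exp (levy_exponent b 0 \<nu> u)" for u
  proof -
    have "\<forall>t\<ge>0. \<forall>u. char (distr M borel (X t)) u = exp (complex_of_real t * levy_exponent b 0 \<nu> u)"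
      using trip unfolding has_levy_triplet_def b_def by blast
    from this[rule_format, of 1 u] show ?thesis by (simp add: Q_def)
  qed
  have \<nu>: "levy_measure \<nu>" using trip by (simp add: has_levy_triplet_def)
  have "integrable \<nu> (\<lambda>x. x\<^sup>2)" using assms(2) by simp
  from Re_exp_levy_exponent_bound[OF \<nu> small this, of b]
  obtain K where "\<And>u. 1 - Re (char Q u) \<le> K * u\<^sup>2" unfolding char_Q by blast
  then have sq: "integrable Q (\<lambda>x. x\<^sup>2)" by (rule second_moment_of_char_bound[OF Q])
  interpret Q: real_distribution Q by (rule Q)
  have "integrable Q (\<lambda>x. x)" by (rule Q.square_integrable_imp_integrable) (use sq in auto)
  then have abs: "integrable Q (\<lambda>x. \<bar>x\<bar>)" by simp
  interpret S: iid_sample M "incr X" Q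
    unfolding Q_def by (rule increments_iid_sample[OF levy abs[unfolded Q_def]])
  have hat: "phi_hat X n u \<omega> = S.ecf n u \<omega>" for n u \<omega>
    by (simp add: phi_hat_def S.ecf_def)
  have phi: "phi M X u = char Q u" for u by (simp add: phi_def Q_def)
  have "c1 > 0" using assms(6) by (simp add: talagrand_constant_def)
  then have \<kappa>: "\<kappa> > 0" using assms(4,7) by (smt (verit) real_sqrt_ge_zero)
  define m where "m = (\<integral>x. \<bar>x\<bar> \<partial>Q)"
  have m: "m \<ge> 0" by (simp add: m_def)
  define K0 where "K0 = ((2 * \<kappa> + 1) / \<kappa>)\<^sup>2 + (2 * \<kappa> + 1)\<^sup>2 * (1 + (2 * \<kappa> + 1) / \<kappa>)\<^sup>2"
  have K0: "K0 \<ge> 0" by (simp add: K0_def)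
  define R where "R n u \<omega> = (cmod (1 / phi_check \<kappa> \<delta> X n u \<omega> - 1 / phi M X u))\<^sup>2 /
        min (ln (real n) * (inverse (weight \<delta> u))\<^sup>2 * inverse (real n) / (cmod (phi M X u)) ^ 4)
            (1 / (cmod (phi M X u))\<^sup>2)" for n u \<omega>
  have R_le: "R n u \<omega> \<le> K0 * (1 + d) ^ 4"
    if n: "n \<ge> 2" and d: "d \<ge> 0" and close: "cmod (S.ecf n u \<omega> - char Q u) \<le> d * threshold 1 \<delta> n u"
    for n u \<omega> d
  proof -
    have T: "threshold 1 \<delta> n u > 0"
      using threshold_ge_inverse(2)[OF assms(3) n, of u] n by (auto intro: less_le_trans[rotated])
    have T2: "(threshold 1 \<delta> n u)\<^sup>2 = ln (real n) * (inverse (weight \<delta> u))\<^sup>2 * inverse (real n)"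
      using n by (simp add: threshold_def power_mult_distrib power_inverse)
    have f: "char Q u \<noteq> 0" by (simp add: char_Q)
    show ?thesis
      using truncated_inverse_error[OF \<kappa> T d f close]
      unfolding R_def phi_check_def hat phi K0_def threshold_scale[of \<kappa>] T2 .
  qed
  show ?thesis
  proof (intro exI allI impI)
    fix n :: nat assume n: "n \<ge> 2"
    have pos: "real n > 0" using n by simp
    show "(\<integral>\<^sup>+ \<omega>. (SUP u::real. ennreal (
        (cmod (1 / phi_check \<kappa> \<delta> X n u \<omega> - 1 / phi M X u))\<^sup>2 /
        min (ln (real n) * (inverse (weight \<delta> u))\<^sup>2 * inverse (real n) / (cmod (phi M X u)) ^ 4)
            (1 / (cmod (phi M X u))\<^sup>2))) \<partial>M)
        \<le> ennreal (K0 * (1 + (13 + m)) ^ 4 + 256 * K0 * (4 * (pi\<^sup>2 / 6) + m))"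
      unfolding R_def[symmetric]
    proof (rule nn_integral_two_level_bound[where A="S.exceptional \<delta> n" and b="256 * K0 * (real n)\<^sup>2"])
      have "prob (S.exceptional \<delta> n) * (256 * K0 * (real n)\<^sup>2)
          \<le> (4 * (pi\<^sup>2 / 6) + m) / (real n)\<^sup>2 * (256 * K0 * (real n)\<^sup>2)"
        using S.prob_exceptional[OF assms(3) n] K0 unfolding m_def by (intro mult_right_mono) auto
      then show "prob (S.exceptional \<delta> n) * (256 * K0 * (real n)\<^sup>2) \<le> 256 * K0 * (4 * (pi\<^sup>2 / 6) + m)"
        using pos by (simp add: mult_ac)
    next
      fix \<omega> assume \<omega>: "\<omega> \<in> space M - S.exceptional \<delta> n"
      show "(SUP u. ennreal (R n u \<omega>)) \<le> ennreal (K0 * (1 + (13 + m)) ^ 4)"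
        using S.uniform_deviation[OF assms(3) n \<omega>] m
        by (intro SUP_least ennreal_leI R_le[OF n]) (auto simp: m_def)
    next
      fix \<omega>
      have "R n u \<omega> \<le> 256 * K0 * (real n)\<^sup>2" for u
      proof -
        have "R n u \<omega> \<le> K0 * (1 + 3 * sqrt (real n)) ^ 4"
          by (intro R_le[OF n] S.trivial_deviation[OF assms(3) n]) auto
        also have "\<dots> \<le> K0 * (4 * sqrt (real n)) ^ 4"
          using n K0 by (intro mult_left_mono power_mono) auto
        also have "(4 * sqrt (real n)) ^ 4 = 256 * (real n)\<^sup>2"
          using power_mult[of "sqrt (real n)" 2 2] by (simp add: power_mult_distrib)
        finally show ?thesis by (simp add: mult_ac)
      qed
      then show "(SUP u. ennreal (R n u \<omega>)) \<le> ennreal (256 * K0 * (real n)\<^sup>2)"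
        by (intro SUP_least ennreal_leI)
    qed (use K0 m in auto)
  qed
qed

end
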